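(* Assume the following. (1) The functions $\bar r:\mathbb{Z}\to\mathbb{R}$, $V^*:\mathbb{X}\to\mathbb{R}$, $Q^*:\mathbb{Z}\to\mathbb{R}$ are bounded and measurable; for each $x\in\mathbb{X}$ the map $a\mapsto Q^*(x,a)$ is continuous on $\mathbb{A}$ and $V^*(x)=\max_{a\in\mathbb{A}}Q^*(x,a)$; for each $n\ge1$ and each $\omega\in\Omega$ the map $\widehat Q_n(\omega,\cdot):\mathbb{Z}\to\mathbb{R}$ is measurable and, for each $x\in\mathbb{X}$, $a\mapsto\widehat Q_n(\omega,x,a)$ is continuous on $\mathbb{A}$. (2) There are $q\in[0,1]$, random variables $\delta_n,\Lambda_n(q)>0$ $(n\ge1)$ on $(\Omega,\mathcal{F},P)$, a constant $C_\delta<\infty$ and, for each integer $k\ge2$, a constant $C_{\Lambda,k}<\infty$ such that for every $n\ge1$ and every $\omega\in\Omega$ $$\sup_{z\in\mathbb{Z}}|\widehat Q_n(z)-Q^*(z)|\le\delta_n,\qquad \sup_{x\in\mathbb{X}}\sup_{a\ne b}\frac{\left|\left(\widehat Q_n(x,a)-Q^*(x,a)\right)-\left(\widehat Q_n(x,b)-Q^*(x,b)\right)\right|}{|a-b|^q}\le\Lambda_n(q),$$ and $E[\delta_n^2]\le C_\delta/n$, $E[\Lambda_n(q)^k]\le C_{\Lambda,k}\,n^{-k/2}$ for all $n\ge1$ and all integers $k\ge2$. (3) There are a probability measure $\lambda_\mu$ on $\mathbb{X}$ and a constant $C_{\mathrm{conc}}<\infty$ such that for every $\pi\in\Pi_{\mathrm{SD}}$,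 $\nu^\pi_\mu\ll\lambda_\mu$ and $\operatorname{ess\,sup}_{\lambda_\mu}\frac{d\nu^\pi_\mu}{d\lambda_\mu}\le C_{\mathrm{conc}}$. (4) There exist $p>q$ and a constant $g_\wedge>0$ such that $$V^*(x)-Q^*(x,a)\ge g_\wedge\,\mathrm{dist}(a,\mathbb{A}^*(x))^p$$ for all $a\in\mathbb{A}$ and for $\lambda_\mu$-a.e. $x\in\mathbb{X}$. Then for each $n\ge1$ there exists a measurable random variable $R_n$ on $(\Omega,\mathcal{F},P)$ with $R_n\ge\mathrm{Regret}(\hat\pi_n;\mu)$ such that for all $n\ge1$ $$E[R_n]\le C\,n^{-p/(2(p-q))}$$ for some constant $C<\infty$ (independent of $n$) depending on $\gamma,C_{\mathrm{conc}},p,q,g_\wedge$ and $C_{\Lambda,k_*}$, where $k_*:=\max\{\lceil p/(p-q)\rceil,2\}$.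
   Context: Control problem. $\mathbb{X}\subset\mathbb{R}^{d_{\mathbb{X}}}$ (states), $\mathbb{A}\subset\mathbb{R}^{d_{\mathbb{A}}}$ (actions; nonempty, compact, convex), $\mathbb{W}\subset\mathbb{R}^{d_{\mathbb{W}}}$ (noise) carry their Borel $\sigma$-fields; $\mathbb{Z}:=\mathbb{X}\times\mathbb{A}$ has the product $\sigma$-field; $|\cdot|$ is the Euclidean norm. $\gamma\in(0,1)$ is a discount factor. $f:\mathbb{X}\times\mathbb{A}\times\mathbb{W}\to\mathbb{X}$ and $r:\mathbb{X}\times\mathbb{A}\times\mathbb{W}\to\mathbb{R}$ are measurable, $\psi$ is a probability measure on $\mathbb{W}$, $r(z,\cdot)$ is $\psi$-integrable for each $z$, and $\bar r(z):=\int r(z,w)\,\psi(dw)$. The transition kernel is $P(B\mid z):=\psi(\{w: f(z,w)\in B\})$ (distinguished by context from the probability $P$ below). $\Pi_{\mathrm{HD}}$ is the set of sequences $\pi=(\pi_t)_{t\ge0}$ of measurable maps $\pi_t:\mathbb{X}^{t+1}\to\mathbb{A}$ and $\Pi_{\mathrm{SD}}\subset\Pi_{\mathrm{HD}}$ the stationary deterministic policies, identified with measurable maps $\pi:\mathbb{X}\to\mathbb{A}$. Under $\mathbb{P}_\mu$ (expectation $\mathbb{E}_\mu$), $X_0\sim\mu$ and $W_1,W_2,\dots$ are i.i.d. with law $\psi$, independent of $X_0$. Given $\pi$: $X_0^\pi:=X_0$, $A_t^\pi:=\pi_t(X_t^\pi,\dots,X_0^\pi)$, $X_{t+1}^\pi:=f(X_t^\pi,A_t^\pi,W_{t+1})$.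 The value is $V^\pi(\mu):=\mathbb{E}_\mu[\sum_{t\ge0}\gamma^t r(X_t^\pi,A_t^\pi,W_{t+1})]=\mathbb{E}_\mu[\sum_{t\ge0}\gamma^t\bar r(X_t^\pi,A_t^\pi)]$, with $\bar r$ treated as the effective reward (the last expression may be taken as the definition). $V^\pi(x):=V^\pi(\delta_x)$, $V^*(x):=\sup_{\pi\in\Pi_{\mathrm{HD}}}V^\pi(x)$, $V^*(\mu):=\int V^*d\mu$, and $$Q^*(z):=\bar r(z)+\gamma\int_{\mathbb{X}}V^*(x')\,P(dx'\mid z),\quad z=(x,a)\in\mathbb{Z}.$$ $\mathbb{A}^*(x):=\{a\in\mathbb{A}:Q^*(x,a)=V^*(x)\}$. For a fixed initial distribution $\mu$ on $\mathbb{X}$ and $\pi\in\Pi_{\mathrm{SD}}$, $\mathrm{Regret}(\pi;\mu):=V^*(\mu)-V^\pi(\mu)$, and the discounted occupancy measure is $\nu_\mu^\pi(B):=(1-\gamma)\sum_{t\ge0}\gamma^t\,\mathbb{P}_\mu(X_t^\pi\in B)$. Estimators. $(\Omega,\mathcal{F},P)$ is a separate probability space, with expectation $E$, such that $\mathcal{F}$ contains all $P$-null sets. For each $n\ge1$, $\widehat Q_n$ assigns to each $\omega\in\Omega$ a function $\widehat Q_n(\omega,\cdot)$ on $\mathbb{Z}$ (no joint measurability in $(\omega,z)$ is assumed; $\omega$ is suppressed in notation). For each $\omega$, $\hat\pi_n(\omega,\cdot):\mathbb{X}\to\mathbb{A}$ is a measurable selector with $\hat\pi_n(\omega,x)\in\arg\max_{a\in\mathbb{A}}\widehat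 Q_n(\omega,x,a)$ for all $x\in\mathbb{X}$. The inequality $R_n\ge\mathrm{Regret}(\hat\pi_n;\mu)$ is understood for each $\omega$. *)

theory Defs
  imports "HOL-Probability.Probability"
begin

record ('x, 'a, 'w) problem =
  states :: "'x set"
  actions :: "'a set"
  noises :: "'w set"
  dynamics :: "'x \<times> 'a \<Rightarrow> 'w \<Rightarrow> 'x"
  reward :: "'x \<times> 'a \<Rightarrow> 'w \<Rightarrow> real"
  noise_law :: "'w measure"
  discount :: real

(* The state, action and noise sets are arbitrary subsets of Euclidean spaces, not assumed Borel;
   each carries the trace of the Borel sigma-field. *)

definition state_space :: "('x::euclidean_space, 'a::euclidean_space, 'w::euclidean_space) problem \<Rightarrow> 'x measure"
  where "state_space M = restrict_space borel (states M)"

definition action_space :: "('x::euclidean_space, 'a::euclidean_space, 'w::euclidean_space) problem \<Rightarrow> 'a measure"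
  where "action_space M = restrict_space borel (actions M)"

definition noise_space :: "('x::euclidean_space, 'a::euclidean_space, 'w::euclidean_space) problem \<Rightarrow> 'w measure"
  where "noise_space M = restrict_space borel (noises M)"

definition state_action_space ::
    "('x::euclidean_space, 'a::euclidean_space, 'w::euclidean_space) problem \<Rightarrow> ('x \<times> 'a) measure"
  where "state_action_space M = state_space M \<Otimes>\<^sub>M action_space M"

definition control_problem ::
    "('x::euclidean_space, 'a::euclidean_space, 'w::euclidean_space) problem \<Rightarrow> bool"
  where "control_problem M \<longleftrightarrow>
    actions M \<noteq> {} \<and> compact (actions M) \<and> convex (actions M) \<and>
    0 < discount M \<and> discount M < 1 \<and>
    prob_space (noise_law M) \<and> sets (noise_law M) = sets (noise_space M) \<and>
    (\<lambda>(z, w). dynamics M z w)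
      \<in> state_action_space M \<Otimes>\<^sub>M noise_space M \<rightarrow>\<^sub>M state_space M \<and>
    (\<lambda>(z, w). reward M z w)
      \<in> borel_measurable (state_action_space M \<Otimes>\<^sub>M noise_space M) \<and>
    (\<forall>z \<in> states M \<times> actions M. integrable (noise_law M) (reward M z))"

definition mean_reward ::
    "('x::euclidean_space, 'a::euclidean_space, 'w::euclidean_space) problem \<Rightarrow> 'x \<times> 'a \<Rightarrow> real"
  where "mean_reward M z = (\<integral>w. reward M z w \<partial>noise_law M)"

definition transition ::
    "('x::euclidean_space, 'a::euclidean_space, 'w::euclidean_space) problem \<Rightarrow> 'x \<times> 'a \<Rightarrow> 'x measure"
  where "transition M z = distr (noise_law M) (state_space M) (dynamics M z)"

(* The history available at time t is a point h of the product of t + 1 copies of the state space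
   indexed by {..t}, with h i the state at time i. *)

definition HD_policies ::
    "('x::euclidean_space, 'a::euclidean_space, 'w::euclidean_space) problem \<Rightarrow> (nat \<Rightarrow> (nat \<Rightarrow> 'x) \<Rightarrow> 'a) set"
  where "HD_policies M =
    {\<pi>. \<forall>t. \<pi> t \<in> (\<Pi>\<^sub>M i\<in>{..t}. state_space M) \<rightarrow>\<^sub>M action_space M}"

definition SD_policies ::
    "('x::euclidean_space, 'a::euclidean_space, 'w::euclidean_space) problem \<Rightarrow> ('x \<Rightarrow> 'a) set"
  where "SD_policies M = state_space M \<rightarrow>\<^sub>M action_space M"

definition stationary :: "('x \<Rightarrow> 'a) \<Rightarrow> nat \<Rightarrow> (nat \<Rightarrow> 'x) \<Rightarrow> 'a"
  where "stationary \<pi> = (\<lambda>t h. \<pi> (h t))"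

(* Canonical probability space: a sample is a pair (x, w) consisting of the initial state x and a
   noise sequence w, where w t is the noise driving the step from time t to time t + 1. *)

definition sample_space ::
    "('x::euclidean_space, 'a::euclidean_space, 'w::euclidean_space) problem \<Rightarrow> 'x measure \<Rightarrow> ('x \<times> (nat \<Rightarrow> 'w)) measure"
  where "sample_space M \<mu> = \<mu> \<Otimes>\<^sub>M (\<Pi>\<^sub>M t\<in>(UNIV :: nat set). noise_law M)"

primrec history ::
    "('x::euclidean_space, 'a::euclidean_space, 'w::euclidean_space) problem \<Rightarrow>
      (nat \<Rightarrow> (nat \<Rightarrow> 'x) \<Rightarrow> 'a) \<Rightarrow> 'x \<times> (nat \<Rightarrow> 'w) \<Rightarrow> nat \<Rightarrow> nat \<Rightarrow> 'x"
  where
    "history M \<pi> s 0 = (\<lambda>i\<in>{..0}. fst s)"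
  | "history M \<pi> s (Suc t) =
      (history M \<pi> s t)
        (Suc t := dynamics M (history M \<pi> s t t, \<pi> t (history M \<pi> s t)) (snd s t))"

definition state_at ::
    "('x::euclidean_space, 'a::euclidean_space, 'w::euclidean_space) problem \<Rightarrow>
      (nat \<Rightarrow> (nat \<Rightarrow> 'x) \<Rightarrow> 'a) \<Rightarrow> nat \<Rightarrow> 'x \<times> (nat \<Rightarrow> 'w) \<Rightarrow> 'x"
  where "state_at M \<pi> t s = history M \<pi> s t t"

definition action_at ::
    "('x::euclidean_space, 'a::euclidean_space, 'w::euclidean_space) problem \<Rightarrow>
      (nat \<Rightarrow> (nat \<Rightarrow> 'x) \<Rightarrow> 'a) \<Rightarrow> nat \<Rightarrow> 'x \<times> (nat \<Rightarrow> 'w) \<Rightarrow> 'a"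
  where "action_at M \<pi> t s = \<pi> t (history M \<pi> s t)"

definition policy_value ::
    "('x::euclidean_space, 'a::euclidean_space, 'w::euclidean_space) problem \<Rightarrow>
      (nat \<Rightarrow> (nat \<Rightarrow> 'x) \<Rightarrow> 'a) \<Rightarrow> 'x measure \<Rightarrow> real"
  where "policy_value M \<pi> \<mu> =
    (\<integral>s. (\<Sum>t. discount M ^ t * mean_reward M (state_at M \<pi> t s, action_at M \<pi> t s))
      \<partial>sample_space M \<mu>)"

(* The series, integral and supremum below are real-valued, hence meaningful only when the mean
   reward is bounded and measurable. *)

definition opt_value ::
    "('x::euclidean_space, 'a::euclidean_space, 'w::euclidean_space) problem \<Rightarrow> 'x \<Rightarrow> real"
  where "opt_value M x = (SUP \<pi>\<in>HD_policies M. policy_value M \<pi> (return (state_space M) x))"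

definition opt_Q ::
    "('x::euclidean_space, 'a::euclidean_space, 'w::euclidean_space) problem \<Rightarrow> 'x \<times> 'a \<Rightarrow> real"
  where "opt_Q M z = mean_reward M z + discount M * (\<integral>x. opt_value M x \<partial>transition M z)"

definition opt_actions ::
    "('x::euclidean_space, 'a::euclidean_space, 'w::euclidean_space) problem \<Rightarrow> 'x \<Rightarrow> 'a set"
  where "opt_actions M x = {a \<in> actions M. opt_Q M (x, a) = opt_value M x}"

definition regret ::
    "('x::euclidean_space, 'a::euclidean_space, 'w::euclidean_space) problem \<Rightarrow> 'x measure \<Rightarrow> ('x \<Rightarrow> 'a) \<Rightarrow> real"
  where "regret M \<mu> \<pi> = (\<integral>x. opt_value M x \<partial>\<mu>) - policy_value M (stationary \<pi>) \<mu>"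

definition occupancy ::
    "('x::euclidean_space, 'a::euclidean_space, 'w::euclidean_space) problem \<Rightarrow> 'x measure \<Rightarrow> ('x \<Rightarrow> 'a) \<Rightarrow> 'x measure"
  where "occupancy M \<mu> \<pi> = measure_of (states M) (sets (state_space M))
    (\<lambda>B. ennreal (1 - discount M) *
      (\<Sum>t. ennreal (discount M ^ t) *
        emeasure (sample_space M \<mu>)
          {s \<in> space (sample_space M \<mu>). state_at M (stationary \<pi>) t s \<in> B}))"

definition k_star :: "real \<Rightarrow> real \<Rightarrow> nat"
  where "k_star p q = max (nat \<lceil>p / (p - q)\<rceil>) 2"

end

theory Submission
  imports Defs
begin

text \<open>By the performance difference identity, the regret of a stationary policy is
  \<open>\<Sum>t. \<gamma> ^ t * E (V*(X t) - Q*(X t, \<pi> (X t)))\<close>. At a maximiser of the estimated \<open>Q\<close>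
  the optimality gap is at most \<open>\<Lambda> * d powr q\<close>, with \<open>d\<close> the distance to the optimal actions, and by the
  margin condition at least \<open>g * d powr p\<close>; eliminating \<open>d\<close> bounds the gap by
  a multiple of \<open>\<Lambda> powr (p / (p - q))\<close> outside a null set that the chain never visits, by
  absolute continuity of the occupancy measure. The moment of order \<open>p / (p - q)\<close> is then
  interpolated from the moment of order \<open>k_star p q\<close>.\<close>

section \<open>Moment interpolation on a probability space\<close>

text \<open>For an exponent in \<open>[0, 1]\<close> the power is at most \<open>max 1 u\<close>.
  This crude bound takes the place of Jensen's inequality in the next lemma.\<close>

lemma powr_le_one_plus:
  fixes u s :: real
  assumes "0 \<le> u" "0 \<le> s" "s \<le> 1"
  shows "u powr s \<le> 1 + u"
proof (cases "u \<le> 1")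
  case True
  have "u powr s \<le> 1 powr s"
    using assms True by (intro powr_mono2) auto
  then show ?thesis using assms by simp
next
  case False
  then have "u powr s \<le> u powr 1"
    using assms by (intro powr_mono) auto
  then show ?thesis using False by simp
qed

text \<open>Lyapunov's inequality up to the factor 2. After division by \<open>c\<close> the
  variable \<open>f x ^ k / c\<close> has mean at most 1, so its power \<open>s = m / k\<close>,
  bounded by one plus itself, has mean at most 2; undoing the normalisation gives the factor
  \<open>c powr s\<close>.\<close>

lemma (in prob_space) integral_powr_le:
  fixes f :: "'a \<Rightarrow> real" and k :: nat
  assumes [measurable]: "f \<in> borel_measurable M"
    and pos: "\<And>x. x \<in> space M \<Longrightarrow> 0 < f x"
    and int: "integrable M (\<lambda>x. f x ^ k)"
    and le: "(\<integral>x. f x ^ k \<partial>M) \<le> c" and "0 < c"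
    and m: "0 \<le> m" "m \<le> real k" "0 < k"
  shows "integrable M (\<lambda>x. f x powr m)"
    and "(\<integral>x. f x powr m \<partial>M) \<le> 2 * c powr (m / real k)"
proof -
  define s where "s = m / real k"
  have s: "0 \<le> s" "s \<le> 1" and ks: "real k * s = m"
    using m by (auto simp: s_def field_simps)
  have bound: "f x powr m \<le> c powr s * (1 + f x ^ k / c)" if "x \<in> space M" for x
  proof -
    have "f x powr m = (f x ^ k) powr s"
      using pos[OF that] by (simp add: powr_realpow[symmetric] powr_powr ks)
    also have "\<dots> = c powr s * (f x ^ k / c) powr s"
      using pos[OF that] \<open>0 < c\<close> by (simp add: powr_divide)
    also have "\<dots> \<le> c powr s * (1 + f x ^ k / c)"
      using pos[OF that] \<open>0 < c\<close> s by (intro mult_left_mono powr_le_one_plus) auto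
    finally show ?thesis .
  qed
  have int': "integrable M (\<lambda>x. c powr s * (1 + f x ^ k / c))"
    using int by (intro integrable_mult_right Bochner_Integration.integrable_add) auto
  show int2: "integrable M (\<lambda>x. f x powr m)"
    by (rule Bochner_Integration.integrable_bound[OF int'])
      (use bound in \<open>auto intro!: AE_I2 order_trans[OF bound]\<close>)
  have "(\<integral>x. f x powr m \<partial>M) \<le> (\<integral>x. c powr s * (1 + f x ^ k / c) \<partial>M)"
    by (intro integral_mono int2 int' bound)
  also have "\<dots> = c powr s * (1 + (\<integral>x. f x ^ k \<partial>M) / c)"
    using int by (simp add: prob_space)
  also have "\<dots> \<le> c powr s * 2"
    using le \<open>0 < c\<close> by (intro mult_left_mono) auto
  finally show "(\<integral>x. f x powr m \<partial>M) \<le> 2 * c powr (m / real k)"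
    by (simp add: s_def)
qed

section \<open>The Markov chain driven by a stationary policy\<close>

locale controlled_chain =
  fixes M :: "('x::euclidean_space, 'a::euclidean_space, 'w::euclidean_space) problem"
    and \<mu> :: "'x measure" and \<pi> :: "'x \<Rightarrow> 'a"
  assumes control: "control_problem M"
    and prob_init: "prob_space \<mu>"
    and sets_init [measurable_cong]: "sets \<mu> = sets (state_space M)"
    and policy: "\<pi> \<in> SD_policies M"
begin

abbreviation "S \<equiv> sample_space M \<mu>"
abbreviation "X \<equiv> state_at M (stationary \<pi>)"
abbreviation "W \<equiv> \<Pi>\<^sub>M t\<in>(UNIV :: nat set). noise_law M"
abbreviation "\<gamma> \<equiv> discount M"

lemma sets_noise [measurable_cong]: "sets (noise_law M) = sets (noise_space M)"
  and discount_pos: "0 < \<gamma>" and discount_less_1: "\<gamma> < 1"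
  using control by (auto simp: control_problem_def)

lemma measurable_policy [measurable]: "\<pi> \<in> state_space M \<rightarrow>\<^sub>M action_space M"
  using policy by (simp add: SD_policies_def)

lemma measurable_dynamics [measurable]:
  "(\<lambda>(z, w). dynamics M z w) \<in> state_action_space M \<Otimes>\<^sub>M noise_space M \<rightarrow>\<^sub>M state_space M"
  using control by (simp add: control_problem_def)

lemma space_state_space: "space (state_space M) = states M"
  and space_state_action_space: "space (state_action_space M) = states M \<times> actions M"
  by (auto simp: state_space_def action_space_def state_action_space_def
      space_restrict_space space_pair_measure)

sublocale init: prob_space \<mu>
  by (rule prob_init)

sublocale noise: sequence_space "noise_law M"
proof -
  interpret prob_space "noise_law M"
    using control by (simp add: control_problem_def)
  show "sequence_space (noise_law M)"
    by unfold_locales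
qed

sublocale sample: prob_space S
  unfolding sample_space_def
  by (intro prob_space_pair prob_init noise.P.prob_space_axioms)

lemma state_at_0: "X 0 s = fst s"
  by (simp add: state_at_def)

lemma state_at_Suc: "X (Suc t) s = dynamics M (X t s, \<pi> (X t s)) (snd s t)"
  by (simp add: state_at_def stationary_def)

lemma action_at_stationary: "action_at M (stationary \<pi>) t s = \<pi> (X t s)"
  by (simp add: action_at_def state_at_def stationary_def)

lemma measurable_state_action [measurable]:
  "(\<lambda>x. (x, \<pi> x)) \<in> state_space M \<rightarrow>\<^sub>M state_action_space M"
  unfolding state_action_space_def by measurable

lemma measurable_dynamics_policy [measurable]:
  "(\<lambda>(x, w). dynamics M (x, \<pi> x) w) \<in> state_space M \<Otimes>\<^sub>M noise_law M \<rightarrow>\<^sub>M state_space M"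
proof -
  have "(\<lambda>(x, w). ((x, \<pi> x), w)) \<in> state_space M \<Otimes>\<^sub>M noise_law M \<rightarrow>\<^sub>M state_action_space M \<Otimes>\<^sub>M noise_space M"
    by measurable
  from measurable_comp[OF this measurable_dynamics] show ?thesis
    by (simp add: comp_def split_beta')
qed

lemma measurable_state_at [measurable]: "X t \<in> S \<rightarrow>\<^sub>M state_space M"
proof (induction t)
  case 0
  show ?case unfolding state_at_0 sample_space_def by measurable
next
  case (Suc t)
  note [measurable] = Suc
  have [measurable]: "(\<lambda>s. snd s t) \<in> S \<rightarrow>\<^sub>M noise_law M"
    unfolding sample_space_def by measurable
  have "(\<lambda>s. (\<lambda>(x, w). dynamics M (x, \<pi> x) w) (X t s, snd s t)) \<in> S \<rightarrow>\<^sub>M state_space M"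
    by measurable
  then show ?case by (simp add: state_at_Suc)
qed

text \<open>Noise coordinate \<open>t\<close> drives the step out of time \<open>t\<close>, so the
  state at time \<open>t\<close> has seen only the coordinates below \<open>t\<close>. This makes it
  independent of the next noise.\<close>

lemma state_at_cong:
  assumes "\<And>i. i < t \<Longrightarrow> w i = w' i"
  shows "X t (x, w) = X t (x, w')"
  using assms by (induction t) (simp_all add: state_at_0 state_at_Suc)

lemma integrable_state_action:
  fixes h :: "'x \<times> 'a \<Rightarrow> real"
  assumes [measurable]: "h \<in> borel_measurable (state_action_space M)"
    and "\<And>z. z \<in> states M \<times> actions M \<Longrightarrow> \<bar>h z\<bar> \<le> b"
  shows "integrable S (\<lambda>s. h (X t s, \<pi> (X t s)))"
proof (rule sample.integrable_const_bound[where B = b])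
  have "(X t s, \<pi> (X t s)) \<in> states M \<times> actions M" if "s \<in> space S" for s
    using measurable_space[OF measurable_comp[OF measurable_state_at measurable_state_action] that]
    by (simp add: space_state_action_space)
  then show "AE s in S. norm (h (X t s, \<pi> (X t s))) \<le> b"
    using assms(2) by (intro AE_I2) simp
qed measurable

lemma integrable_state:
  fixes v :: "'x \<Rightarrow> real"
  assumes [measurable]: "v \<in> borel_measurable (state_space M)"
    and "\<And>x. x \<in> states M \<Longrightarrow> \<bar>v x\<bar> \<le> b"
  shows "integrable S (\<lambda>s. v (X t s))"
proof (rule sample.integrable_const_bound[where B = b])
  show "AE s in S. norm (v (X t s)) \<le> b"
    using assms(2) measurable_space[OF measurable_state_at]
    by (intro AE_I2) (simp add: space_state_space)
qed measurable

text \<open>The Markov property at time \<open>t\<close>: \<open>comb_seq\<close> replaces the noise from time \<open>t\<close> on by an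
  independent copy, which leaves the state at time \<open>t\<close> unchanged.\<close>

lemma integral_state_at_Suc:
  fixes v :: "'x \<Rightarrow> real"
  assumes v [measurable]: "v \<in> borel_measurable (state_space M)"
    and b: "\<And>x. x \<in> states M \<Longrightarrow> \<bar>v x\<bar> \<le> b"
  shows "(\<integral>s. v (X (Suc t) s) \<partial>S) = (\<integral>s. (\<integral>y. v y \<partial>transition M (X t s, \<pi> (X t s))) \<partial>S)"
proof -
  interpret SW: pair_sigma_finite \<mu> W ..
  interpret WW: pair_prob_space W W ..
  \<comment> \<open>\<open>k x w\<close> is \<open>v\<close> at the successor of \<open>x\<close>
    under noise \<open>w\<close>; averaging over \<open>w\<close> gives the one-step conditional
    expectation of \<open>v\<close>.\<close>
  define k where "k x w = v (dynamics M (x, \<pi> x) w)" for x w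
  have k [measurable]: "(\<lambda>(x, w). k x w) \<in> borel_measurable (state_space M \<Otimes>\<^sub>M noise_law M)"
    using measurable_comp[OF measurable_dynamics_policy v] by (simp add: k_def comp_def split_beta')
  have Xpair: "(\<lambda>w. X t (x, w)) \<in> W \<rightarrow>\<^sub>M state_space M" if "x \<in> space \<mu>" for t x
    using measurable_comp[OF measurable_Pair1'[OF that] measurable_state_at[unfolded sample_space_def]]
    by (simp add: comp_def)
  have dyn: "dynamics M (x, \<pi> x) \<in> noise_law M \<rightarrow>\<^sub>M state_space M" if "x \<in> states M" for x
    using measurable_comp[OF measurable_Pair1' measurable_dynamics_policy, of x] that
    by (simp add: comp_def space_state_space)
  have k_bound: "\<bar>k x w\<bar> \<le> b" if "x \<in> states M" "w \<in> space (noise_law M)" for x w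
    using measurable_space[OF dyn[OF that(1)] that(2)] b by (simp add: k_def space_state_space)
  have trans: "(\<integral>w. k x w \<partial>noise_law M) = (\<integral>y. v y \<partial>transition M (x, \<pi> x))" if "x \<in> states M" for x
    unfolding transition_def k_def using dyn[OF that] by (subst integral_distr) auto
  \<comment> \<open>Averaging preserves the bound \<open>b\<close>, so the conditional expectation
    is again integrable along the chain, as Fubini requires at the end.\<close>
  have bK: "\<bar>\<integral>w. k x w \<partial>noise_law M\<bar> \<le> b" if x: "x \<in> states M" for x
  proof -
    have [measurable]: "k x \<in> borel_measurable (noise_law M)"
      using measurable_comp[OF dyn[OF x] v] by (simp add: k_def[abs_def] comp_def)
    have "integrable (noise_law M) (k x)"
      by (rule noise.M.integrable_const_bound[where B = b]) (use k_bound[OF x] in auto)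
    then have "\<bar>\<integral>w. k x w \<partial>noise_law M\<bar> \<le> (\<integral>w. \<bar>k x w\<bar> \<partial>noise_law M)"
      by (intro integral_abs_bound)
    also have "\<dots> \<le> (\<integral>w. b \<partial>noise_law M)"
      using \<open>integrable _ (k x)\<close> k_bound[OF x] by (intro integral_mono) auto
    finally show ?thesis by (simp add: noise.M.prob_space)
  qed
  have K [measurable]: "(\<lambda>x. \<integral>w. k x w \<partial>noise_law M) \<in> borel_measurable (state_space M)"
    by (rule noise.M.borel_measurable_lebesgue_integral) measurable
  have inner: "(\<integral>w. v (X (Suc t) (x, w)) \<partial>W) =
      (\<integral>w. (\<integral>w'. k (X t (x, w)) w' \<partial>noise_law M) \<partial>W)" if x: "x \<in> space \<mu>" for x
  proof -
    note [measurable] = Xpair[OF x]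
    have XS: "X t (x, w) \<in> states M" if "w \<in> space W" for w
      using measurable_space[OF Xpair[OF x] that] by (simp add: space_state_space)
    have m: "(\<lambda>w. v (X (Suc t) (x, w))) \<in> borel_measurable W"
      using x by measurable
    have m2 [measurable]: "(\<lambda>(w, w'). k (X t (x, w)) (w' 0)) \<in> borel_measurable (W \<Otimes>\<^sub>M W)"
    proof -
      have "(\<lambda>(w, w'). (X t (x, w), w' 0)) \<in> W \<Otimes>\<^sub>M W \<rightarrow>\<^sub>M state_space M \<Otimes>\<^sub>M noise_law M"
        by measurable
      from measurable_comp[OF this k] show ?thesis
        by (simp add: comp_def split_beta')
    qed
    have "(\<integral>w. v (X (Suc t) (x, w)) \<partial>W)
        = (\<integral>w. v (X (Suc t) (x, w)) \<partial>distr (W \<Otimes>\<^sub>M W) W (\<lambda>(w, w'). comb_seq t w w'))"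
      by (simp only: noise.PiM_comb_seq)
    also have "\<dots> = (\<integral>p. v (X (Suc t) (x, case p of (w, w') \<Rightarrow> comb_seq t w w')) \<partial>(W \<Otimes>\<^sub>M W))"
      by (intro integral_distr measurable_comb_seq m)
    \<comment> \<open>The step from \<open>t\<close> to \<open>Suc t\<close> consumes noise
      coordinate \<open>t\<close>, and coordinate \<open>t\<close> of \<open>comb_seq t w w'\<close>
      is the first coordinate of the fresh copy, hence \<open>w' 0\<close>.\<close>
    also have "\<dots> = (\<integral>p. (\<lambda>(w, w'). k (X t (x, w)) (w' 0)) p \<partial>(W \<Otimes>\<^sub>M W))"
    proof (intro Bochner_Integration.integral_cong refl)
      fix p assume "p \<in> space (W \<Otimes>\<^sub>M W)"
      obtain w w' where p: "p = (w, w')" by force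
      have "X t (x, comb_seq t w w') = X t (x, w)"
        by (rule state_at_cong) (simp add: comb_seq_def)
      then show "v (X (Suc t) (x, case p of (w, w') \<Rightarrow> comb_seq t w w'))
          = (\<lambda>(w, w'). k (X t (x, w)) (w' 0)) p"
        by (simp add: p state_at_Suc k_def comb_seq_def)
    qed
    also have "\<dots> = (\<integral>w. (\<integral>w'. k (X t (x, w)) (w' 0) \<partial>W) \<partial>W)"
    proof -
      have "integrable (W \<Otimes>\<^sub>M W) (\<lambda>(w, w'). k (X t (x, w)) (w' 0))"
      proof (rule WW.integrable_const_bound[where B = b])
        show "AE p in W \<Otimes>\<^sub>M W. norm ((\<lambda>(w, w'). k (X t (x, w)) (w' 0)) p) \<le> b"
          by (intro AE_I2)
            (auto simp: space_pair_measure space_PiM PiE_iff intro!: k_bound XS)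
      qed measurable
      from WW.integral_fst'[OF this] show ?thesis by simp
    qed
    \<comment> \<open>Coordinate 0 of the noise sequence has law \<open>noise_law M\<close>, so the
      inner integral reduces to a single noise variable.\<close>
    also have "\<dots> = (\<integral>w. (\<integral>w'. k (X t (x, w)) w' \<partial>noise_law M) \<partial>W)"
    proof (intro Bochner_Integration.integral_cong refl)
      fix w assume w: "w \<in> space W"
      have [measurable]: "k (X t (x, w)) \<in> borel_measurable (noise_law M)"
        using measurable_comp[OF dyn[OF XS[OF w]] v] by (simp add: k_def[abs_def] comp_def)
      have "(\<integral>w'. k (X t (x, w)) w' \<partial>noise_law M)
          = (\<integral>w'. k (X t (x, w)) w' \<partial>distr W (noise_law M) (\<lambda>w'. w' 0))"
        by (simp only: noise.PiM_component[OF UNIV_I])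
      also have "\<dots> = (\<integral>w'. k (X t (x, w)) (w' 0) \<partial>W)"
        by (intro integral_distr) measurable
      finally show "(\<integral>w'. k (X t (x, w)) (w' 0) \<partial>W) = (\<integral>w'. k (X t (x, w)) w' \<partial>noise_law M)"
        by simp
    qed
    finally show ?thesis .
  qed
  have int1: "integrable S (\<lambda>s. v (X (Suc t) s))"
    by (rule integrable_state[OF v b])
  have int2: "integrable S (\<lambda>s. \<integral>w. k (X t s) w \<partial>noise_law M)"
    by (rule integrable_state[OF K bK])
  have "(\<integral>s. v (X (Suc t) s) \<partial>S) = (\<integral>x. (\<integral>w. v (X (Suc t) (x, w)) \<partial>W) \<partial>\<mu>)"
    using SW.integral_fst'[OF int1[unfolded sample_space_def]] by (simp add: sample_space_def)
  also have "\<dots> = (\<integral>x. (\<integral>w. (\<integral>w'. k (X t (x, w)) w' \<partial>noise_law M) \<partial>W) \<partial>\<mu>)"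
    by (intro Bochner_Integration.integral_cong refl inner)
  also have "\<dots> = (\<integral>s. (\<integral>w. k (X t s) w \<partial>noise_law M) \<partial>S)"
    using SW.integral_fst'[OF int2[unfolded sample_space_def]] by (simp add: sample_space_def)
  also have "\<dots> = (\<integral>s. (\<integral>y. v y \<partial>transition M (X t s, \<pi> (X t s))) \<partial>S)"
    using measurable_space[OF measurable_state_at]
    by (intro Bochner_Integration.integral_cong refl trans) (simp add: space_state_space)
  finally show ?thesis .
qed

text \<open>The performance difference identity: the one-step defects of \<open>v\<close> telescope along the chain.\<close>

lemma performance_difference:
  fixes v :: "'x \<Rightarrow> real" and Q :: "'x \<times> 'a \<Rightarrow> real"
  assumes r: "mean_reward M \<in> borel_measurable (state_action_space M)"
      "\<And>z. z \<in> states M \<times> actions M \<Longrightarrow> \<bar>mean_reward M z\<bar> \<le> br"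
    and v: "v \<in> borel_measurable (state_space M)" "\<And>x. x \<in> states M \<Longrightarrow> \<bar>v x\<bar> \<le> bv"
    and Q: "Q \<in> borel_measurable (state_action_space M)"
      "\<And>z. z \<in> states M \<times> actions M \<Longrightarrow> \<bar>Q z\<bar> \<le> bQ"
    and Q_eq: "\<And>z. Q z = mean_reward M z + \<gamma> * (\<integral>y. v y \<partial>transition M z)"
  shows "(\<lambda>t. \<gamma> ^ t * (\<integral>s. v (X t s) - Q (X t s, \<pi> (X t s)) \<partial>S))
    sums ((\<integral>x. v x \<partial>\<mu>) - policy_value M (stationary \<pi>) \<mu>)"
proof -
  define V where "V t = (\<integral>s. v (X t s) \<partial>S)" for t
  define R where "R t = (\<integral>s. mean_reward M (X t s, \<pi> (X t s)) \<partial>S)" for t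
  note int_r = integrable_state_action[OF r]
  note int_v = integrable_state[OF v]
  note int_Q = integrable_state_action[OF Q]
  have XA: "(X t s, \<pi> (X t s)) \<in> states M \<times> actions M" if "s \<in> space S" for t s
    using measurable_space[OF measurable_comp[OF measurable_state_at measurable_state_action] that]
    by (simp add: space_state_action_space)
  have geom: "summable (\<lambda>t. \<gamma> ^ t * c)" for c :: real
    using discount_pos discount_less_1 by (intro summable_mult2 summable_geometric) simp
  \<comment> \<open>\<open>Q\<close> minus the mean reward is \<gamma> times the transition average
    of \<open>v\<close>, whose expectation at time \<open>t\<close> is \<open>V (Suc t)\<close> by
    the Markov property.\<close>
  have step: "(\<integral>s. v (X t s) - Q (X t s, \<pi> (X t s)) \<partial>S) = V t - \<gamma> * V (Suc t) - R t" for t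
  proof -
    have "(\<integral>s. Q (X t s, \<pi> (X t s)) \<partial>S) - R t
        = (\<integral>s. Q (X t s, \<pi> (X t s)) - mean_reward M (X t s, \<pi> (X t s)) \<partial>S)"
      unfolding R_def using int_Q int_r by simp
    also have "\<dots> = \<gamma> * (\<integral>s. (\<integral>y. v y \<partial>transition M (X t s, \<pi> (X t s))) \<partial>S)"
      by (simp add: Q_eq)
    also have "\<dots> = \<gamma> * V (Suc t)"
      unfolding V_def by (subst integral_state_at_Suc[OF v]) simp_all
    finally show ?thesis
      using int_v int_Q by (simp add: V_def)
  qed
  have V_bound: "\<bar>V t\<bar> \<le> bv" for t
  proof -
    have "\<bar>V t\<bar> \<le> (\<integral>s. \<bar>v (X t s)\<bar> \<partial>S)"
      unfolding V_def by (intro integral_abs_bound)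
    also have "\<dots> \<le> (\<integral>s. bv \<partial>S)"
      using int_v XA v(2) by (intro integral_mono) auto
    finally show ?thesis by (simp add: sample.prob_space)
  qed
  \<comment> \<open>The boundary term of the telescoping sum vanishes, because \<open>V\<close> is
    bounded and the discount is geometric; only \<open>V 0\<close> survives.\<close>
  have "(\<lambda>t. \<gamma> ^ t * V t) \<longlonglongrightarrow> 0"
  proof (rule Lim_null_comparison)
    show "\<forall>\<^sub>F t in sequentially. norm (\<gamma> ^ t * V t) \<le> \<gamma> ^ t * bv"
      using V_bound discount_pos by (auto simp: abs_mult intro!: always_eventually mult_left_mono)
    show "(\<lambda>t. \<gamma> ^ t * bv) \<longlonglongrightarrow> 0"
      by (rule summable_LIMSEQ_zero[OF geom])
  qed
  from telescope_sums'[OF this]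
  have tele: "(\<lambda>t. \<gamma> ^ t * V t - \<gamma> ^ Suc t * V (Suc t)) sums V 0"
    by simp
  have S0: "V 0 = (\<integral>x. v x \<partial>\<mu>)"
  proof -
    interpret SW: pair_sigma_finite \<mu> W ..
    have "V 0 = (\<integral>x. (\<integral>w. v (X 0 (x, w)) \<partial>W) \<partial>\<mu>)"
      unfolding V_def using SW.integral_fst'[OF int_v[of 0, unfolded sample_space_def]]
      by (simp add: sample_space_def)
    then show ?thesis by (simp add: state_at_0 noise.P.prob_space)
  qed
  have abs_r: "\<bar>\<gamma> ^ t * mean_reward M (X t s, \<pi> (X t s))\<bar> \<le> \<gamma> ^ t * br" if "s \<in> space S" for t s
    using r(2)[OF XA[OF that]] discount_pos by (auto simp: abs_mult intro!: mult_left_mono)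
  \<comment> \<open>\<open>policy_value\<close> has the series inside the expectation, whereas the
    telescoping runs over expectations. The exchange is dominated by the geometric series with terms
    \<open>\<gamma> ^ t * br\<close>.\<close>
  have "(\<lambda>t. \<integral>s. \<gamma> ^ t * mean_reward M (X t s, \<pi> (X t s)) \<partial>S) sums
      (\<integral>s. (\<Sum>t. \<gamma> ^ t * mean_reward M (X t s, \<pi> (X t s))) \<partial>S)"
  proof (rule sums_integral)
    show "integrable S (\<lambda>s. \<gamma> ^ t * mean_reward M (X t s, \<pi> (X t s)))" for t
      using int_r by simp
    show "AE s in S. summable (\<lambda>t. norm (\<gamma> ^ t * mean_reward M (X t s, \<pi> (X t s))))"
      using abs_r by (intro AE_I2 summable_comparison_test'[OF geom[of br], of 0]) simp
    show "summable (\<lambda>t. \<integral>s. norm (\<gamma> ^ t * mean_reward M (X t s, \<pi> (X t s))) \<partial>S)"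
    proof (rule summable_comparison_test'[OF geom[of br], of 0])
      fix t
      have "(\<integral>s. norm (\<gamma> ^ t * mean_reward M (X t s, \<pi> (X t s))) \<partial>S) \<le> (\<integral>s. \<gamma> ^ t * br \<partial>S)"
        using int_r abs_r by (intro integral_mono integrable_norm integrable_mult_right) auto
      then show "norm (\<integral>s. norm (\<gamma> ^ t * mean_reward M (X t s, \<pi> (X t s))) \<partial>S) \<le> \<gamma> ^ t * br"
        by (simp add: sample.prob_space integral_nonneg_AE)
    qed
  qed
  then have "(\<lambda>t. \<gamma> ^ t * R t) sums policy_value M (stationary \<pi>) \<mu>"
    by (simp add: policy_value_def action_at_stationary R_def)
  from sums_diff[OF tele this] show ?thesis
    by (simp add: step S0 algebra_simps)
qed

section \<open>The occupancy measure and its null sets\<close>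

text \<open>\<open>measure_of\<close> returns its set function only if that function is countably
  additive, and the zero measure otherwise. Additivity holds because the function is a discounted
  mixture of the laws of the states \<open>X t\<close>.\<close>

lemma emeasure_occupancy:
  assumes B: "B \<in> sets (state_space M)"
  shows "emeasure (occupancy M \<mu> \<pi>) B = ennreal (1 - \<gamma>) *
    (\<Sum>t. ennreal (\<gamma> ^ t) * emeasure S {s \<in> space S. X t s \<in> B})"
proof -
  define D where "D t = distr S (state_space M) (X t)" for t
  define f where "f B = ennreal (1 - \<gamma>) *
    (\<Sum>t. ennreal (\<gamma> ^ t) * emeasure S {s \<in> space S. X t s \<in> B})" for B
  \<comment> \<open>The sum over times is written as an integral over counting measure, so that
    interchanging the two series is an instance of \<open>nn_integral_suminf\<close>.\<close>
  have f_eq: "f B = ennreal (1 - \<gamma>) * (\<integral>\<^sup>+t. ennreal (\<gamma> ^ t) * emeasure (D t) B \<partial>count_space UNIV)"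
    if "B \<in> sets (state_space M)" for B
    using that unfolding f_def D_def
    by (simp add: emeasure_distr nn_integral_count_space_nat vimage_def Int_def conj_commute)
  have "countably_additive (sets (state_space M)) f"
  proof (rule countably_additiveI)
    fix A :: "nat \<Rightarrow> 'x set"
    assume A: "range A \<subseteq> sets (state_space M)" "disjoint_family A" "(\<Union>i. A i) \<in> sets (state_space M)"
    have "(\<Sum>i. f (A i)) = ennreal (1 - \<gamma>) *
        (\<Sum>i. \<integral>\<^sup>+t. ennreal (\<gamma> ^ t) * emeasure (D t) (A i) \<partial>count_space UNIV)"
      using A by (subst f_eq) auto
    also have "\<dots> = ennreal (1 - \<gamma>) *
        (\<integral>\<^sup>+t. (\<Sum>i. ennreal (\<gamma> ^ t) * emeasure (D t) (A i)) \<partial>count_space UNIV)"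
      by (subst nn_integral_suminf) auto
    also have "\<dots> = f (\<Union>i. A i)"
      using A by (simp add: f_eq suminf_emeasure D_def)
    finally show "(\<Sum>i. f (A i)) = f (\<Union>i. A i)" .
  qed
  moreover have eq: "occupancy M \<mu> \<pi> = measure_of (space (state_space M)) (sets (state_space M)) f"
    by (simp add: occupancy_def f_def[abs_def] space_state_space)
  moreover have "sets (occupancy M \<mu> \<pi>) = sets (state_space M)"
    unfolding eq by (rule sets.sets_measure_of_eq)
  ultimately have "emeasure (occupancy M \<mu> \<pi>) B = f B"
    using B by (intro emeasure_measure_of[OF eq sets.space_closed]) (auto simp: positive_def f_def)
  then show ?thesis by (simp add: f_def)
qed

text \<open>The occupancy measure charges the law of every \<open>X t\<close> with the positive
  weight \<open>(1 - \<gamma>) * \<gamma> ^ t\<close>. Hence a \<open>lam\<close>-null set, being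
  null for the occupancy measure, is avoided almost surely at each time.\<close>

lemma AE_state_at:
  assumes sets_lam: "sets lam = sets (state_space M)"
    and ac: "absolutely_continuous lam (occupancy M \<mu> \<pi>)"
    and ae: "AE x in lam. P x"
  shows "AE s in S. P (X t s)"
proof -
  \<comment> \<open>The set where \<open>P\<close> fails need not be measurable; a measurable null
    superset \<open>N\<close> is pulled back along \<open>X t\<close> in its place.\<close>
  from ae obtain N where N: "{x \<in> space lam. \<not> P x} \<subseteq> N" "emeasure lam N = 0" "N \<in> sets lam"
    by (rule AE_E)
  have NS: "N \<in> sets (state_space M)"
    using N sets_lam by simp
  have "N \<in> null_sets (occupancy M \<mu> \<pi>)"
    using N ac by (auto simp: absolutely_continuous_def null_sets_def)
  then have "(\<Sum>t. ennreal (\<gamma> ^ t) * emeasure S {s \<in> space S. X t s \<in> N}) = 0"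
    using emeasure_occupancy[OF NS] discount_less_1 by (auto simp: null_sets_def)
  then have "ennreal (\<gamma> ^ t) * emeasure S {s \<in> space S. X t s \<in> N} = 0"
    using suminf_eq_zero_iff[of "\<lambda>t. ennreal (\<gamma> ^ t) * emeasure S {s \<in> space S. X t s \<in> N}"] by simp
  moreover have "\<not> \<gamma> ^ t \<le> 0"
    using discount_pos by (simp add: not_le)
  ultimately have zero: "emeasure S {s \<in> space S. X t s \<in> N} = 0"
    by (simp add: ennreal_eq_0_iff)
  show ?thesis
  proof (rule AE_I[OF _ zero])
    show "{s \<in> space S. \<not> P (X t s)} \<subseteq> {s \<in> space S. X t s \<in> N}"
      using N(1) measurable_space[OF measurable_state_at] sets_eq_imp_space_eq[OF sets_lam] by auto
    show "{s \<in> space S. X t s \<in> N} \<in> sets S"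
      using NS by measurable
  qed
qed

end

section \<open>The optimality gap at a maximiser of the estimated Q-function\<close>

lemma margin_gap_le:
  fixes Q Qh :: "'a::euclidean_space \<Rightarrow> real"
  assumes "compact A" and Q: "continuous_on A Q" "\<And>a. a \<in> A \<Longrightarrow> Q a \<le> m"
    and Opt: "Opt = {a \<in> A. Q a = m}" "Opt \<noteq> {}"
    and \<alpha>: "\<alpha> \<in> A" "\<And>a. a \<in> A \<Longrightarrow> Qh a \<le> Qh \<alpha>"
    and hoelder: "\<And>a b. a \<in> A \<Longrightarrow> b \<in> A \<Longrightarrow> a \<noteq> b \<Longrightarrow>
      \<bar>(Qh a - Q a) - (Qh b - Q b)\<bar> \<le> L * norm (a - b) powr q"
    and margin: "g * infdist \<alpha> Opt powr p \<le> m - Q \<alpha>"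
    and pq: "0 \<le> q" "q < p" "0 < g" "0 < L"
  shows "m - Q \<alpha> \<le> g powr (- (q / (p - q))) * L powr (p / (p - q))"
proof -
  \<comment> \<open>Closedness makes the distance from \<open>\<alpha>\<close> to the optimal
    actions attained at some \<open>b\<close>, so the Hoelder bound can be applied to the pair
    \<open>\<alpha>\<close>, \<open>b\<close>.\<close>
  have "closed Opt"
    using continuous_closed_preimage_constant[OF Q(1) compact_imp_closed[OF \<open>compact A\<close>], of m]
    unfolding Opt(1) .
  then obtain b where b: "b \<in> Opt" "infdist \<alpha> Opt = dist \<alpha> b"
    using infdist_attains_inf[OF _ Opt(2)] by metis
  show ?thesis
  \<comment> \<open>At \<open>\<alpha> = b\<close> the gap is zero. This case is separate because
    the Hoelder bound speaks only of distinct actions and a power of \<open>d\<close> is cancelled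
    below.\<close>
  proof (cases "\<alpha> = b")
    case True
    then show ?thesis using b Opt by simp
  next
    case False
    define d where "d = norm (\<alpha> - b)"
    have d: "0 < d" "infdist \<alpha> Opt = d"
      using False b by (auto simp: d_def dist_norm)
    have bA: "b \<in> A" "Q b = m" using b Opt by auto
    \<comment> \<open>Since \<open>Qh \<alpha>\<close> is at least \<open>Qh b\<close> and
      \<open>Q b = m\<close>, the gap is at most the difference of the errors \<open>Qh - Q\<close>
      at \<open>\<alpha>\<close> and at \<open>b\<close>.\<close>
    have gap: "m - Q \<alpha> \<le> L * d powr q"
      using hoelder[OF \<alpha>(1) bA(1) False] \<alpha>(2)[OF bA(1)] bA(2) unfolding d_def by linarith
    have "g * d powr p \<le> L * d powr q"
      using gap margin d by simp
    moreover have "d powr p = d powr (p - q) * d powr q"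
      by (simp add: powr_add[symmetric])
    ultimately have "g * d powr (p - q) \<le> L"
      using d by simp
    then have "d powr (p - q) \<le> L / g"
      using pq by (simp add: field_simps)
    \<comment> \<open>Raising to the power \<open>q / (p - q)\<close> turns the bound on
      \<open>d powr (p - q)\<close> into one on \<open>d powr q\<close>, the quantity occurring in
      \<open>gap\<close>.\<close>
    then have "(d powr (p - q)) powr (q / (p - q)) \<le> (L / g) powr (q / (p - q))"
      using pq d by (intro powr_mono2) auto
    moreover have "(d powr (p - q)) powr (q / (p - q)) = d powr q"
      using pq by (simp add: powr_powr)
    moreover have "L * (L / g) powr (q / (p - q)) = g powr (- (q / (p - q))) * L powr (p / (p - q))"
    proof -
      have "p / (p - q) = 1 + q / (p - q)"
        using pq by (simp add: field_simps)
      then have "L powr (p / (p - q)) = L * L powr (q / (p - q))"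
        using pq by (simp add: powr_add)
      then show ?thesis
        using pq by (simp add: powr_divide powr_minus divide_simps)
    qed
    ultimately show ?thesis
      using gap pq by (smt (verit) mult_left_mono)
  qed
qed

text \<open>The exceptional null set of the margin condition depends on the action; by separability and
  continuity a single null set suffices.\<close>

lemma AE_all_compact:
  fixes f h :: "'x \<Rightarrow> 'a::euclidean_space \<Rightarrow> real"
  assumes "compact A"
    and cont: "\<And>x. x \<in> space M \<Longrightarrow> continuous_on A (f x)"
      "\<And>x. x \<in> space M \<Longrightarrow> continuous_on A (h x)"
    and ae: "\<And>a. a \<in> A \<Longrightarrow> AE x in M. h x a \<le> f x a"
  shows "AE x in M. \<forall>a\<in>A. h x a \<le> f x a"
proof -
  obtain T where T: "countable T" "T \<subseteq> A" "A \<subseteq> closure T"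
    by (rule separable)
  have cl: "closure T = A"
    using T compact_imp_closed[OF \<open>compact A\<close>] closure_minimal by blast
  have "AE x in M. \<forall>a\<in>T. h x a \<le> f x a"
    using T ae by (subst AE_ball_countable) auto
  then show ?thesis
  proof (rule AE_mp, intro AE_I2 impI ballI)
    fix x a assume x: "x \<in> space M" and le: "\<forall>a\<in>T. h x a \<le> f x a" and "a \<in> A"
    have "0 \<le> f x a - h x a"
    proof (rule continuous_ge_on_closure[where S = T])
      show "continuous_on (closure T) (\<lambda>a. f x a - h x a)"
        using cont[OF x] unfolding cl by (intro continuous_on_diff)
    qed (use le \<open>a \<in> A\<close> cl in auto)
    then show "h x a \<le> f x a" by simp
  qed
qed

section \<open>From the gap bound to the regret and its rate\<close>

text \<open>The regret is the discounted sum of the expected gaps along the chain. An almost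
  everywhere bound \<open>b\<close> on the gap transfers to every time, and the geometric series
  supplies \<open>1 / (1 - \<gamma>)\<close>.\<close>

lemma (in controlled_chain) regret_le:
  assumes r: "bounded (mean_reward M ` (states M \<times> actions M))"
      "mean_reward M \<in> borel_measurable (state_action_space M)"
    and v: "bounded (opt_value M ` states M)" "opt_value M \<in> borel_measurable (state_space M)"
    and Q: "bounded (opt_Q M ` (states M \<times> actions M))"
      "opt_Q M \<in> borel_measurable (state_action_space M)"
    and lam: "sets lam = sets (state_space M)" "absolutely_continuous lam (occupancy M \<mu> \<pi>)"
    and gap: "AE x in lam. opt_value M x - opt_Q M (x, \<pi> x) \<le> b"
  shows "regret M \<mu> \<pi> \<le> b / (1 - \<gamma>)"
proof -
  obtain br bv bQ where
    br: "\<And>z. z \<in> states M \<times> actions M \<Longrightarrow> \<bar>mean_reward M z\<bar> \<le> br" and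
    bv: "\<And>x. x \<in> states M \<Longrightarrow> \<bar>opt_value M x\<bar> \<le> bv" and
    bQ: "\<And>z. z \<in> states M \<times> actions M \<Longrightarrow> \<bar>opt_Q M z\<bar> \<le> bQ"
    using r(1) v(1) Q(1) unfolding bounded_iff real_norm_def by (metis imageI)
  \<comment> \<open>The definition of \<open>opt_Q\<close> is exactly the one-step relation that the
    performance difference identity asks of \<open>Q\<close> and \<open>v\<close>.\<close>
  have sums: "(\<lambda>t. \<gamma> ^ t * (\<integral>s. opt_value M (X t s) - opt_Q M (X t s, \<pi> (X t s)) \<partial>S))
      sums regret M \<mu> \<pi>"
    unfolding regret_def
    by (rule performance_difference[OF r(2) br v(2) bv Q(2) bQ opt_Q_def])
  have "(\<integral>s. opt_value M (X t s) - opt_Q M (X t s, \<pi> (X t s)) \<partial>S) \<le> b" for t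
  proof -
    have "(\<integral>s. opt_value M (X t s) - opt_Q M (X t s, \<pi> (X t s)) \<partial>S) \<le> (\<integral>s. b \<partial>S)"
      using integrable_state[OF v(2) bv, of t] integrable_state_action[OF Q(2) bQ, of t]
        AE_state_at[OF lam gap, of t]
      by (intro integral_mono_AE) auto
    then show ?thesis by (simp add: sample.prob_space)
  qed
  moreover have "(\<lambda>t. \<gamma> ^ t * b) sums (1 / (1 - \<gamma>) * b)"
    using discount_pos discount_less_1 by (intro sums_mult2 geometric_sums) simp
  ultimately have "regret M \<mu> \<pi> \<le> 1 / (1 - \<gamma>) * b"
    using discount_pos by (intro sums_le[OF _ sums]) (auto intro!: mult_left_mono)
  then show ?thesis by simp
qed

theorem theorem1:
  fixes \<gamma> C_conc p q g C_star :: real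
  assumes "0 \<le> q" and "q \<le> 1" and "q < p" and "0 < g"
  shows "\<exists>C :: real.
    \<forall>(M :: ('x::euclidean_space, 'a::euclidean_space, 'w::euclidean_space) problem)
      (\<mu> :: 'x measure) (lam :: 'x measure) (P :: 'o measure)
      (Qh :: nat \<Rightarrow> 'o \<Rightarrow> 'x \<times> 'a \<Rightarrow> real) (\<pi>h :: nat \<Rightarrow> 'o \<Rightarrow> 'x \<Rightarrow> 'a)
      (\<delta> :: nat \<Rightarrow> 'o \<Rightarrow> real) (\<Lambda> :: nat \<Rightarrow> 'o \<Rightarrow> real)
      (C_\<delta> :: real) (C_\<Lambda> :: nat \<Rightarrow> real).
      control_problem M \<and> discount M = \<gamma> \<and>
      prob_space \<mu> \<and> sets \<mu> = sets (state_space M) \<and>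
      prob_space P \<and> complete_measure P \<and>
      (\<forall>n\<ge>1. \<forall>\<omega>\<in>space P. \<pi>h n \<omega> \<in> SD_policies M \<and>
        (\<forall>x\<in>states M. is_arg_max (\<lambda>a. Qh n \<omega> (x, a)) (\<lambda>a. a \<in> actions M) (\<pi>h n \<omega> x)))
      \<longrightarrow>
      bounded (mean_reward M ` (states M \<times> actions M)) \<and>
      mean_reward M \<in> borel_measurable (state_action_space M) \<and>
      bounded (opt_value M ` states M) \<and>
      opt_value M \<in> borel_measurable (state_space M) \<and>
      bounded (opt_Q M ` (states M \<times> actions M)) \<and>
      opt_Q M \<in> borel_measurable (state_action_space M) \<and>
      (\<forall>x\<in>states M. continuous_on (actions M) (\<lambda>a. opt_Q M (x, a)) \<and>
        (\<exists>a\<in>actions M. opt_Q M (x, a) = opt_value M x) \<and>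
        (\<forall>a\<in>actions M. opt_Q M (x, a) \<le> opt_value M x)) \<and>
      (\<forall>n\<ge>1. \<forall>\<omega>\<in>space P. Qh n \<omega> \<in> borel_measurable (state_action_space M) \<and>
        (\<forall>x\<in>states M. continuous_on (actions M) (\<lambda>a. Qh n \<omega> (x, a))))
      \<longrightarrow>
      (\<forall>n\<ge>1. \<delta> n \<in> borel_measurable P \<and> \<Lambda> n \<in> borel_measurable P \<and>
        (\<forall>\<omega>\<in>space P. 0 < \<delta> n \<omega> \<and> 0 < \<Lambda> n \<omega> \<and>
          (SUP z\<in>states M \<times> actions M. ereal \<bar>Qh n \<omega> z - opt_Q M z\<bar>) \<le> ereal (\<delta> n \<omega>) \<and>
          (SUP x\<in>states M. SUP (a, b)\<in>{(a, b). a \<in> actions M \<and> b \<in> actions M \<and> a \<noteq> b}.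
            ereal (\<bar>(Qh n \<omega> (x, a) - opt_Q M (x, a)) - (Qh n \<omega> (x, b) - opt_Q M (x, b))\<bar>
              / norm (a - b) powr q)) \<le> ereal (\<Lambda> n \<omega>)) \<and>
        integrable P (\<lambda>\<omega>. (\<delta> n \<omega>)\<^sup>2) \<and>
        (\<integral>\<omega>. (\<delta> n \<omega>)\<^sup>2 \<partial>P) \<le> C_\<delta> / real n \<and>
        (\<forall>k\<ge>2. integrable P (\<lambda>\<omega>. \<Lambda> n \<omega> ^ k) \<and>
          (\<integral>\<omega>. \<Lambda> n \<omega> ^ k \<partial>P) \<le> C_\<Lambda> k * real n powr (- (real k / 2)))) \<and>
      C_\<Lambda> (k_star p q) = C_star
      \<longrightarrow>
      prob_space lam \<and> sets lam = sets (state_space M) \<and>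
      (\<forall>\<pi>\<in>SD_policies M. absolutely_continuous lam (occupancy M \<mu> \<pi>) \<and>
        esssup lam (RN_deriv lam (occupancy M \<mu> \<pi>)) \<le> ennreal C_conc)
      \<longrightarrow>
      (\<forall>a\<in>actions M. AE x in lam.
        opt_value M x - opt_Q M (x, a) \<ge> g * infdist a (opt_actions M x) powr p)
      \<longrightarrow>
      (\<exists>R :: nat \<Rightarrow> 'o \<Rightarrow> real. \<forall>n\<ge>1.
        R n \<in> borel_measurable P \<and>
        (\<forall>\<omega>\<in>space P. R n \<omega> \<ge> regret M \<mu> (\<pi>h n \<omega>)) \<and>
        integrable P (R n) \<and>
        (\<integral>\<omega>. R n \<omega> \<partial>P) \<le> C * real n powr (- (p / (2 * (p - q)))))"
proof -
  define m where "m = p / (p - q)"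
  define k where "k = k_star p q"
  define K where "K = g powr (- (q / (p - q))) / (1 - \<gamma>)"
  \<comment> \<open>\<open>k_star\<close> rounds \<open>m\<close> up, so the moment of order
    \<open>m\<close> can be interpolated, and it is at least 2, so the moment assumption covers
    it.\<close>
  have p: "0 < p" and m: "0 \<le> m" "m \<le> real k" and k: "2 \<le> k"
    using assms by (auto simp: m_def k_def k_star_def) linarith+
  show ?thesis
  \<comment> \<open>\<open>K\<close> collects the factors of \<open>margin_gap_le\<close> and
    \<open>regret_le\<close>; the rest comes from \<open>integral_powr_le\<close>. The constant is
    fixed before the problem and the estimators are.\<close>
  proof (intro exI[of _ "2 * K * C_star powr (m / real k)"] allI impI, goal_cases)
    case (1 M \<mu> lam P Qh \<pi>h \<delta> \<Lambda> C_\<delta> C_\<Lambda>)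
    have ctrl: "control_problem M" and \<gamma>: "discount M = \<gamma>"
      and \<mu>: "prob_space \<mu>" "sets \<mu> = sets (state_space M)"
      and P: "prob_space P"
      and pol: "\<And>n \<omega>. 1 \<le> n \<Longrightarrow> \<omega> \<in> space P \<Longrightarrow> \<pi>h n \<omega> \<in> SD_policies M"
      and amax: "\<And>n \<omega> x. 1 \<le> n \<Longrightarrow> \<omega> \<in> space P \<Longrightarrow> x \<in> states M \<Longrightarrow>
        is_arg_max (\<lambda>a. Qh n \<omega> (x, a)) (\<lambda>a. a \<in> actions M) (\<pi>h n \<omega> x)"
      using 1(1) by blast+
    have r: "bounded (mean_reward M ` (states M \<times> actions M))"
        "mean_reward M \<in> borel_measurable (state_action_space M)"
      and v: "bounded (opt_value M ` states M)" "opt_value M \<in> borel_measurable (state_space M)"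
      and Q: "bounded (opt_Q M ` (states M \<times> actions M))"
        "opt_Q M \<in> borel_measurable (state_action_space M)"
      and Qc: "\<And>x. x \<in> states M \<Longrightarrow> continuous_on (actions M) (\<lambda>a. opt_Q M (x, a))"
      and Qmax: "\<And>x. x \<in> states M \<Longrightarrow> \<exists>a\<in>actions M. opt_Q M (x, a) = opt_value M x"
      and Qle: "\<And>x a. x \<in> states M \<Longrightarrow> a \<in> actions M \<Longrightarrow> opt_Q M (x, a) \<le> opt_value M x"
      using 1(2) by blast+
    have \<Lambda>: "\<And>n. 1 \<le> n \<Longrightarrow> \<Lambda> n \<in> borel_measurable P"
        "\<And>n \<omega>. 1 \<le> n \<Longrightarrow> \<omega> \<in> space P \<Longrightarrow> 0 < \<Lambda> n \<omega>"
      and SUP: "\<And>n \<omega>. 1 \<le> n \<Longrightarrow> \<omega> \<in> space P \<Longrightarrow>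
        (SUP x\<in>states M. SUP (a, b)\<in>{(a, b). a \<in> actions M \<and> b \<in> actions M \<and> a \<noteq> b}.
            ereal (\<bar>(Qh n \<omega> (x, a) - opt_Q M (x, a)) - (Qh n \<omega> (x, b) - opt_Q M (x, b))\<bar>
              / norm (a - b) powr q)) \<le> ereal (\<Lambda> n \<omega>)"
      and mom: "\<And>n. 1 \<le> n \<Longrightarrow> integrable P (\<lambda>\<omega>. \<Lambda> n \<omega> ^ k)"
        "\<And>n. 1 \<le> n \<Longrightarrow> (\<integral>\<omega>. \<Lambda> n \<omega> ^ k \<partial>P) \<le> C_\<Lambda> k * real n powr (- (real k / 2))"
      and Cst: "C_\<Lambda> k = C_star"
      using 1(3) k unfolding k_def by blast+
    have lam: "sets lam = sets (state_space M)"
      and ac: "\<And>\<pi>. \<pi> \<in> SD_policies M \<Longrightarrow> absolutely_continuous lam (occupancy M \<mu> \<pi>)"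
      using 1(4) by blast+
    note marg = 1(5)[rule_format]
    interpret P: prob_space P by (rule P)
    have \<gamma>01: "0 < \<gamma>" "\<gamma> < 1" and cpt: "compact (actions M)"
      using ctrl \<gamma> by (auto simp: control_problem_def)
    have "0 \<le> K" using \<gamma>01 by (simp add: K_def)
    have space_lam: "space lam = states M"
      using sets_eq_imp_space_eq[OF lam] by (simp add: state_space_def space_restrict_space)
    \<comment> \<open>The action selected by the estimator varies with \<open>x\<close>, so one
      exceptional set must serve all actions.\<close>
    have marg_all: "AE x in lam. \<forall>a\<in>actions M.
        g * infdist a (opt_actions M x) powr p \<le> opt_value M x - opt_Q M (x, a)"
    proof (rule AE_all_compact[OF cpt])
      fix x assume "x \<in> space lam"
      then show "continuous_on (actions M) (\<lambda>a. opt_value M x - opt_Q M (x, a))"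
        using Qc by (intro continuous_intros) (simp add: space_lam)
      show "continuous_on (actions M) (\<lambda>a. g * infdist a (opt_actions M x) powr p)"
        using p by (intro continuous_intros continuous_on_powr') (auto simp: infdist_nonneg)
    qed (rule marg)
    have hoelder: "\<bar>(Qh n \<omega> (x, a) - opt_Q M (x, a)) - (Qh n \<omega> (x, b) - opt_Q M (x, b))\<bar>
        \<le> \<Lambda> n \<omega> * norm (a - b) powr q"
      if n: "1 \<le> n" "\<omega> \<in> space P" and x: "x \<in> states M"
        and ab: "a \<in> actions M" "b \<in> actions M" "a \<noteq> b" for n \<omega> x a b
    proof -
      let ?f = "\<lambda>x (a, b). ereal (\<bar>(Qh n \<omega> (x, a) - opt_Q M (x, a)) - (Qh n \<omega> (x, b) - opt_Q M (x, b))\<bar>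
              / norm (a - b) powr q)"
      let ?D = "{(a, b). a \<in> actions M \<and> b \<in> actions M \<and> a \<noteq> b}"
      have "?f x (a, b) \<le> (SUP e\<in>?D. ?f x e)"
        using ab by (intro SUP_upper) simp
      also have "\<dots> \<le> (SUP x\<in>states M. SUP e\<in>?D. ?f x e)"
        using x by (intro SUP_upper)
      also have "\<dots> \<le> ereal (\<Lambda> n \<omega>)"
        by (rule SUP[OF n])
      finally show ?thesis
        \<comment> \<open>As \<open>a\<close> and \<open>b\<close> differ, the denominator is
          positive and can be cleared.\<close>
        using ab by (simp only: prod.case ereal_less_eq) (simp add: divide_le_eq)
    qed
    have reg: "regret M \<mu> (\<pi>h n \<omega>) \<le> K * \<Lambda> n \<omega> powr m"
      if n: "1 \<le> n" "\<omega> \<in> space P" for n \<omega>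
    proof -
      \<comment> \<open>With \<open>n\<close> and \<omega> fixed the selected policy is
        deterministic, so the chain results apply separately for each \<omega>.\<close>
      have chain: "controlled_chain M \<mu> (\<pi>h n \<omega>)"
        using ctrl \<mu> pol[OF n] by (rule controlled_chain.intro)
      have "AE x in lam. opt_value M x - opt_Q M (x, \<pi>h n \<omega> x)
          \<le> g powr (- (q / (p - q))) * \<Lambda> n \<omega> powr m"
        using marg_all
      proof (rule AE_mp, intro AE_I2 impI)
        fix x assume "x \<in> space lam"
          and mx: "\<forall>a\<in>actions M. g * infdist a (opt_actions M x) powr p \<le> opt_value M x - opt_Q M (x, a)"
        then have x: "x \<in> states M" by (simp add: space_lam)
        have am: "\<pi>h n \<omega> x \<in> actions M"
            "\<And>a. a \<in> actions M \<Longrightarrow> Qh n \<omega> (x, a) \<le> Qh n \<omega> (x, \<pi>h n \<omega> x)"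
          using amax[OF n x] by (auto simp: is_arg_max_def not_less)
        show "opt_value M x - opt_Q M (x, \<pi>h n \<omega> x) \<le> g powr (- (q / (p - q))) * \<Lambda> n \<omega> powr m"
          unfolding m_def
        proof (rule margin_gap_le[where Q = "\<lambda>a. opt_Q M (x, a)" and Qh = "\<lambda>a. Qh n \<omega> (x, a)",
              OF cpt Qc[OF x] Qle[OF x] opt_actions_def[of M x] _ am])
          show "opt_actions M x \<noteq> {}"
            using Qmax[OF x] by (auto simp: opt_actions_def)
          show "g * infdist (\<pi>h n \<omega> x) (opt_actions M x) powr p \<le> opt_value M x - opt_Q M (x, \<pi>h n \<omega> x)"
            using mx am(1) by blast
        qed (use hoelder[OF n x] assms \<Lambda>(2)[OF n] in auto)
      qed
      from controlled_chain.regret_le[OF chain r v Q lam ac[OF pol[OF n]] this] show ?thesis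
        by (simp add: K_def \<gamma>)
    qed
    show ?case
    \<comment> \<open>The regret itself may fail to be measurable in \<omega>; this majorant depends
      on \<omega> only through the random variable \<open>\<Lambda> n\<close>.\<close>
    proof (intro exI[of _ "\<lambda>n \<omega>. K * \<Lambda> n \<omega> powr m"] allI impI conjI ballI)
      fix n :: nat assume n: "1 \<le> n"
      note [measurable] = \<Lambda>(1)[OF n]
      show "(\<lambda>\<omega>. K * \<Lambda> n \<omega> powr m) \<in> borel_measurable P" by measurable
      show "regret M \<mu> (\<pi>h n \<omega>) \<le> K * \<Lambda> n \<omega> powr m" if "\<omega> \<in> space P" for \<omega>
        by (rule reg[OF n that])
      let ?c = "C_star * real n powr (- (real k / 2))"
      have le: "(\<integral>\<omega>. \<Lambda> n \<omega> ^ k \<partial>P) \<le> ?c"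
        using mom(2)[OF n] Cst by simp
      \<comment> \<open>Positivity of \<open>\<Lambda> n\<close> forces a positive moment, hence a
        positive bound \<open>?c\<close> and a positive \<open>C_star\<close>, as the normalisation
        in \<open>integral_powr_le\<close> requires.\<close>
      have "0 < (\<integral>\<omega>. \<Lambda> n \<omega> ^ k \<partial>P)"
        by (rule P.expectation_greater[OF mom(1)[OF n]]) (use \<Lambda>(2)[OF n] in auto)
      then have "0 < ?c" using le by linarith
      then have "0 < C_star" using n by (simp add: zero_less_mult_iff)
      have "0 < k" using k by simp
      note * = P.integral_powr_le[OF \<Lambda>(1)[OF n] \<Lambda>(2)[OF n] mom(1)[OF n] le \<open>0 < ?c\<close> m \<open>0 < k\<close>]
      show "integrable P (\<lambda>\<omega>. K * \<Lambda> n \<omega> powr m)"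
        using *(1) by simp
      have "(\<integral>\<omega>. K * \<Lambda> n \<omega> powr m \<partial>P) \<le> K * (2 * ?c powr (m / real k))"
        using *(2) \<open>0 \<le> K\<close> by (simp add: mult_left_mono)
      \<comment> \<open>The exponents combine to \<open>(k / 2) * (m / k) = m / 2\<close>, so the
        rate does not feel the rounding in \<open>k_star\<close>.\<close>
      also have "?c powr (m / real k) = C_star powr (m / real k) * real n powr (- (m / 2))"
        using \<open>0 < C_star\<close> \<open>0 < k\<close> by (simp add: powr_mult powr_powr)
      also have "m / 2 = p / (2 * (p - q))"
        by (simp add: m_def)
      finally show "(\<integral>\<omega>. K * \<Lambda> n \<omega> powr m \<partial>P)
          \<le> 2 * K * C_star powr (m / real k) * real n powr (- (p / (2 * (p - q))))"
        by (simp add: mult_ac)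
    qed
  qed
qed

end
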